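(* Consider braids on $3$ strands. (1) The sum of all entries of $[EP1]$, that is, $[1]_{1\times 2}[EP1][1]_{k\times 1}$, is a braid invariant; that is, if two braid words on $3$ strands represent the same element of the braid group $B_3$, then the sums of all entries of their $[EP1]$ matrices are equal. (2) If a braid on $3$ strands is trivial, then the sum of all entries of its $[EP1]$ matrix is equal to $0$.
   Context: A braid on $3$ strands of length $k\ge 0$ means a word $w=\sigma_{i_1}^{\varepsilon_1}\cdots\sigma_{i_k}^{\varepsilon_k}$ with $i_t\in\{1,2\}$, $\varepsilon_t\in\{1,-1\}$. Two braids are equal if they represent the same element of $B_3=\langle \sigma_1,\sigma_2\mid \sigma_1\sigma_2\sigma_1=\sigma_2\sigma_1\sigma_2\rangle$ (equivalently, they are related by second and third Reidemeister moves); a braid is trivial if it is equal to the empty braid. A quantity is a braid invariant if it takes the same value on equal braids. Encoding $[EP1]$: the $2\times k$ matrix whose $t$-th column has entry $\varepsilon_t$ in row $i_t$ and $0$ in the other row. $[1]_{m\times n}$ denotes the $m\times n$ matrix with all entries equal to $1$. *)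

theory Defs
  imports "Jordan_Normal_Form.Matrix"
begin

section \<open>Groups given by generators and relations\<close>

text \<open>The letter \<open>(x, e)\<close> stands for the generator \<open>x\<close> with exponent \<open>e\<close>; a word is the list of
  its letters, read from left to right.\<close>

definition group_words :: "'a set \<Rightarrow> ('a \<times> int) list set" where
  "group_words X = lists (X \<times> {1, -1})"

text \<open>The least congruence on words that contains free cancellation and the relations in \<open>R\<close>,
  where \<open>(r, s) \<in> R\<close> stands for the relation \<open>r = s\<close>.\<close>

inductive_set pres_cong ::
    "'a set \<Rightarrow> (('a \<times> int) list \<times> ('a \<times> int) list) set
      \<Rightarrow> (('a \<times> int) list \<times> ('a \<times> int) list) set"
  for X R where
  refl: "u \<in> group_words X \<Longrightarrow> (u, u) \<in> pres_cong X R"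
| sym: "(u, v) \<in> pres_cong X R \<Longrightarrow> (v, u) \<in> pres_cong X R"
| trans: "(u, v) \<in> pres_cong X R \<Longrightarrow> (v, w) \<in> pres_cong X R \<Longrightarrow> (u, w) \<in> pres_cong X R"
| cancel: "u \<in> group_words X \<Longrightarrow> v \<in> group_words X \<Longrightarrow> x \<in> X \<Longrightarrow> e \<in> {1, -1} \<Longrightarrow>
    (u @ [(x, e), (x, -e)] @ v, u @ v) \<in> pres_cong X R"
| rel: "u \<in> group_words X \<Longrightarrow> v \<in> group_words X \<Longrightarrow> (r, s) \<in> R \<Longrightarrow>
    r \<in> group_words X \<Longrightarrow> s \<in> group_words X \<Longrightarrow>
    (u @ r @ v, u @ s @ v) \<in> pres_cong X R"

definition word_class ::
    "'a set \<Rightarrow> (('a \<times> int) list \<times> ('a \<times> int) list) set \<Rightarrow> ('a \<times> int) list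
      \<Rightarrow> ('a \<times> int) list set" where
  "word_class X R w = pres_cong X R `` {w}"

definition presented_group ::
    "'a set \<Rightarrow> (('a \<times> int) list \<times> ('a \<times> int) list) set \<Rightarrow> ('a \<times> int) list set monoid" where
  "presented_group X R =
    \<lparr>carrier = group_words X // pres_cong X R,
     mult = (\<lambda>A B. \<Union>u\<in>A. \<Union>v\<in>B. word_class X R (u @ v)),
     one = word_class X R []\<rparr>"

lemma group_words_Nil [simp]: "[] \<in> group_words X"
  by (simp add: group_words_def)

lemma group_words_append [simp]:
  "u @ v \<in> group_words X \<longleftrightarrow> u \<in> group_words X \<and> v \<in> group_words X"
  by (auto simp: group_words_def)

lemma group_words_Cons [simp]:
  "(x, e) # v \<in> group_words X \<longleftrightarrow> x \<in> X \<and> e \<in> {1, -1} \<and> v \<in> group_words X"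
  by (auto simp: group_words_def)

lemma pres_cong_words:
  "(u, v) \<in> pres_cong X R \<Longrightarrow> u \<in> group_words X \<and> v \<in> group_words X"
  by (induction rule: pres_cong.induct) auto

lemma equiv_pres_cong: "equiv (group_words X) (pres_cong X R)"
proof (rule equivI)
  show "pres_cong X R \<subseteq> group_words X \<times> group_words X"
    using pres_cong_words by fastforce
  show "refl_on (group_words X) (pres_cong X R)"
    by (intro refl_onI pres_cong.refl)
  show "Relation.sym (pres_cong X R)" by (rule symI) (rule pres_cong.sym)
  show "Relation.trans (pres_cong X R)" by (rule transI) (rule pres_cong.trans)
qed

lemma pres_cong_context:
  "(u, v) \<in> pres_cong X R \<Longrightarrow> a \<in> group_words X \<Longrightarrow> b \<in> group_words X \<Longrightarrow>
    (a @ u @ b, a @ v @ b) \<in> pres_cong X R"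
proof (induction rule: pres_cong.induct)
  case (refl u)
  then show ?case by (intro pres_cong.refl) simp
next
  case (sym u v)
  show ?case by (rule pres_cong.sym) (rule sym.IH[OF sym.prems])
next
  case (trans u v w)
  show ?case by (rule pres_cong.trans[OF trans.IH(1)[OF trans.prems] trans.IH(2)[OF trans.prems]])
next
  case (cancel u v x e)
  then show ?case
    using pres_cong.cancel[of "a @ u" X "v @ b" x e R] by simp
next
  case (rel u v r s)
  then show ?case
    using pres_cong.rel[of "a @ u" X "v @ b" r s R] by simp
qed

lemma pres_cong_append:
  assumes "(u, u') \<in> pres_cong X R" "(v, v') \<in> pres_cong X R"
  shows "(u @ v, u' @ v') \<in> pres_cong X R"
proof -
  have "(u @ v, u' @ v) \<in> pres_cong X R"
    using pres_cong_context[OF assms(1), of "[]" v] pres_cong_words[OF assms(2)] by simp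
  moreover have "(u' @ v, u' @ v') \<in> pres_cong X R"
    using pres_cong_context[OF assms(2), of u' "[]"] pres_cong_words[OF assms(1)] by simp
  ultimately show ?thesis by (rule pres_cong.trans)
qed

lemma word_class_eq_iff:
  "u \<in> group_words X \<Longrightarrow> v \<in> group_words X \<Longrightarrow>
    word_class X R u = word_class X R v \<longleftrightarrow> (u, v) \<in> pres_cong X R"
  unfolding word_class_def by (rule eq_equiv_class_iff[OF equiv_pres_cong])

lemma word_class_mult:
  assumes "u \<in> group_words X" "v \<in> group_words X"
  shows "word_class X R u \<otimes>\<^bsub>presented_group X R\<^esub> word_class X R v = word_class X R (u @ v)"
proof -
  have *: "word_class X R (u' @ v') = word_class X R (u @ v)"
    if "u' \<in> word_class X R u" "v' \<in> word_class X R v" for u' v'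
  proof -
    have "(u @ v, u' @ v') \<in> pres_cong X R"
      using that by (auto simp: word_class_def intro: pres_cong_append)
    then show ?thesis
      unfolding word_class_def using equiv_class_eq[OF equiv_pres_cong] by metis
  qed
  have "u \<in> word_class X R u" "v \<in> word_class X R v"
    using assms by (auto simp: word_class_def intro: pres_cong.refl)
  then have "(\<Union>u'\<in>word_class X R u. \<Union>v'\<in>word_class X R v. word_class X R (u' @ v'))
      = word_class X R (u @ v)"
    using * by blast
  then show ?thesis
    by (simp add: presented_group_def)
qed

lemma carrier_presented_group:
  "carrier (presented_group X R) = word_class X R ` group_words X"
  by (auto simp: presented_group_def word_class_def quotient_def)

lemma one_presented_group: "\<one>\<^bsub>presented_group X R\<^esub> = word_class X R []"
  by (simp add: presented_group_def)

lemma inverse_word: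
  assumes "w \<in> group_words X"
  shows "\<exists>w'\<in>group_words X. (w' @ w, []) \<in> pres_cong X R"
  using assms
proof (induction w)
  case Nil
  then show ?case by (auto intro!: bexI[of _ "[]"] pres_cong.refl)
next
  case (Cons a w)
  obtain x e where a: "a = (x, e)" by (cases a)
  from Cons.prems a have w: "x \<in> X" "e \<in> {1, -1}" "w \<in> group_words X" by auto
  then obtain w' where w': "w' \<in> group_words X" "(w' @ w, []) \<in> pres_cong X R"
    using Cons.IH by blast
  have "(w' @ [(x, -e), (x, - (-e))] @ w, w' @ w) \<in> pres_cong X R"
    using w w' by (intro pres_cong.cancel) auto
  then have "((w' @ [(x, -e)]) @ a # w, w' @ w) \<in> pres_cong X R"
    using a by simp
  then have "((w' @ [(x, -e)]) @ a # w, []) \<in> pres_cong X R"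
    using w'(2) by (rule pres_cong.trans)
  moreover have "w' @ [(x, -e)] \<in> group_words X" using w w' by auto
  ultimately show ?case by blast
qed

lemma word_class_in_carrier:
  "w \<in> group_words X \<Longrightarrow> word_class X R w \<in> carrier (presented_group X R)"
  by (simp add: carrier_presented_group)

lemma carrier_presented_groupE:
  assumes "A \<in> carrier (presented_group X R)"
  obtains w where "w \<in> group_words X" "A = word_class X R w"
  using assms unfolding carrier_presented_group by blast

theorem group_presented_group: "group (presented_group X R)" (is "group ?G")
proof (rule groupI)
  show "\<one>\<^bsub>?G\<^esub> \<in> carrier ?G"
    unfolding one_presented_group by (rule word_class_in_carrier) simp
next
  fix A B assume "A \<in> carrier ?G" "B \<in> carrier ?G"
  then obtain u v where "u \<in> group_words X" "A = word_class X R u"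
    "v \<in> group_words X" "B = word_class X R v"
    by (elim carrier_presented_groupE)
  then show "A \<otimes>\<^bsub>?G\<^esub> B \<in> carrier ?G"
    by (simp add: word_class_mult word_class_in_carrier)
next
  fix A B C assume "A \<in> carrier ?G" "B \<in> carrier ?G" "C \<in> carrier ?G"
  then obtain u v w where "u \<in> group_words X" "A = word_class X R u"
    "v \<in> group_words X" "B = word_class X R v" "w \<in> group_words X" "C = word_class X R w"
    by (elim carrier_presented_groupE)
  then show "A \<otimes>\<^bsub>?G\<^esub> B \<otimes>\<^bsub>?G\<^esub> C = A \<otimes>\<^bsub>?G\<^esub> (B \<otimes>\<^bsub>?G\<^esub> C)"
    by (simp add: word_class_mult)
next
  fix A assume "A \<in> carrier ?G"
  then obtain w where w: "w \<in> group_words X" "A = word_class X R w"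
    by (elim carrier_presented_groupE)
  show "\<one>\<^bsub>?G\<^esub> \<otimes>\<^bsub>?G\<^esub> A = A"
    using w by (simp add: one_presented_group word_class_mult)
  obtain w' where w': "w' \<in> group_words X" "(w' @ w, []) \<in> pres_cong X R"
    using inverse_word w(1) by blast
  have "word_class X R w' \<otimes>\<^bsub>?G\<^esub> A = word_class X R (w' @ w)"
    using w w' by (simp add: word_class_mult)
  also have "\<dots> = \<one>\<^bsub>?G\<^esub>"
    using w w' by (simp add: one_presented_group word_class_eq_iff)
  finally show "\<exists>B\<in>carrier ?G. B \<otimes>\<^bsub>?G\<^esub> A = \<one>\<^bsub>?G\<^esub>"
    using w'(1) word_class_in_carrier by blast
qed


section \<open>Braids on three strands\<close>

definition braid3_words :: "(nat \<times> int) list set" where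
  "braid3_words = group_words {1, 2}"

definition braid3_relations :: "((nat \<times> int) list \<times> (nat \<times> int) list) set" where
  "braid3_relations = {([(1, 1), (2, 1), (1, 1)], [(2, 1), (1, 1), (2, 1)])}"

definition B3 :: "(nat \<times> int) list set monoid" where
  "B3 = presented_group {1, 2} braid3_relations"

definition braid3_element :: "(nat \<times> int) list \<Rightarrow> (nat \<times> int) list set" where
  "braid3_element w = word_class {1, 2} braid3_relations w"

lemma group_B3: "group B3"
  unfolding B3_def by (rule group_presented_group)

lemma braid3_element_carrier: "w \<in> braid3_words \<Longrightarrow> braid3_element w \<in> carrier B3"
  by (simp add: braid3_words_def braid3_element_def B3_def carrier_presented_group)

definition braid3_equal :: "(nat \<times> int) list \<Rightarrow> (nat \<times> int) list \<Rightarrow> bool" where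
  "braid3_equal v w \<longleftrightarrow> braid3_element v = braid3_element w"

definition trivial_braid3 :: "(nat \<times> int) list \<Rightarrow> bool" where
  "trivial_braid3 w \<longleftrightarrow> braid3_equal w []"

definition braid3_invariant :: "((nat \<times> int) list \<Rightarrow> 'b) \<Rightarrow> bool" where
  "braid3_invariant f \<longleftrightarrow>
    (\<forall>v\<in>braid3_words. \<forall>w\<in>braid3_words. braid3_equal v w \<longrightarrow> f v = f w)"

text \<open>Matrix indices start at 0, so row \<open>r\<close> belongs to the generator with index \<open>Suc r\<close>.\<close>

definition EP1 :: "(nat \<times> int) list \<Rightarrow> int mat" where
  "EP1 w = mat 2 (length w) (\<lambda>(r, t). if fst (w ! t) = Suc r then snd (w ! t) else 0)"

definition ones_mat :: "nat \<Rightarrow> nat \<Rightarrow> int mat" where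
  "ones_mat m n = mat m n (\<lambda>_. 1)"

end

theory Submission
  imports Defs
begin

text \<open>The entry sum of \<open>EP1 w\<close> is the exponent sum of \<open>w\<close>: each column has one nonzero entry,
  the exponent of the corresponding letter (lemma \<open>sum_mat_EP1\<close>). Exponent sum is additive under
  concatenation, so it can change under a rewriting step only through the subword that is
  replaced. Free cancellation removes two opposite exponents, and the braid relation has
  exponent sum 3 on both sides, so equal braids have equal exponent sums; this is the
  abelianization map from \<open>B3\<close> to the integers. A trivial braid is equal to the empty word, whose
  exponent sum is 0.\<close>

definition exponent_sum :: "('a \<times> int) list \<Rightarrow> int" where
  "exponent_sum w = sum_list (map snd w)"

text \<open>Exponent sum is the homomorphism from the free group that sends every generator to 1. It
  factors through a presented group as soon as it is balanced on each defining relation.\<close>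

lemma exponent_sum_pres_cong:
  assumes "(u, v) \<in> pres_cong X R"
    and "\<And>r s. (r, s) \<in> R \<Longrightarrow> exponent_sum r = exponent_sum s"
  shows "exponent_sum u = exponent_sum v"
  using assms(1)
  by (induction rule: pres_cong.induct) (use assms(2) in \<open>auto simp: exponent_sum_def\<close>)

lemma exponent_sum_braid3_equal:
  assumes "v \<in> braid3_words" "w \<in> braid3_words" "braid3_equal v w"
  shows "exponent_sum v = exponent_sum w"
proof -
  have "(v, w) \<in> pres_cong {1, 2} braid3_relations"
    using assms
    by (simp add: braid3_words_def braid3_equal_def braid3_element_def word_class_eq_iff)
  then show ?thesis
    by (rule exponent_sum_pres_cong) (auto simp: braid3_relations_def exponent_sum_def)
qed

lemma sum_mat_EP1:
  assumes "w \<in> braid3_words"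
  shows "sum_mat (EP1 w) = exponent_sum w"
proof -
  have column: "(\<Sum>r = 0..<2. if fst (w ! t) = Suc r then snd (w ! t) else 0) = snd (w ! t)"
    if "t < length w" for t
  proof -
    have "w ! t \<in> {1, 2} \<times> {1, -1}"
      using assms nth_mem[OF that] by (auto simp: braid3_words_def group_words_def)
    then show ?thesis
      by (auto simp: numeral_2_eq_2)
  qed
  have "sum_mat (EP1 w)
      = (\<Sum>r = 0..<2. \<Sum>t = 0..<length w. if fst (w ! t) = Suc r then snd (w ! t) else 0)"
    by (auto simp: sum_mat_def EP1_def sum.cartesian_product intro!: sum.cong)
  also have "\<dots> = (\<Sum>t = 0..<length w. \<Sum>r = 0..<2. if fst (w ! t) = Suc r then snd (w ! t) else 0)"
    by (rule sum.swap)
  also have "\<dots> = (\<Sum>t = 0..<length w. snd (w ! t))"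
    by (rule sum.cong) (simp_all add: column)
  also have "\<dots> = exponent_sum w"
    by (simp add: exponent_sum_def sum_list_sum_nth)
  finally show ?thesis .
qed

text \<open>Multiplying by a row of ones on the left sums each column, and multiplying by a column of
  ones on the right then adds the column sums.\<close>

lemma ones_mat_mult_ones_mat:
  assumes "A \<in> carrier_mat m n"
  shows "ones_mat 1 m * A * ones_mat n 1 = mat 1 1 (\<lambda>_. sum_mat A)"
proof -
  have "(\<Sum>j = 0..<n. \<Sum>i = 0..<m. A $$ (i, j)) = sum_mat A"
    using assms sum.swap[of "\<lambda>i j. A $$ (i, j)" "{0..<n}" "{0..<m}"]
    by (auto simp: sum_mat_def sum.cartesian_product)
  with assms show ?thesis
    by (intro eq_matI) (auto simp: ones_mat_def scalar_prod_def)
qed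

theorem theorem2:
  shows "(\<forall>w\<in>braid3_words.
            ones_mat 1 2 * EP1 w * ones_mat (length w) 1 = mat 1 1 (\<lambda>_. sum_mat (EP1 w)))
       \<and> braid3_invariant (\<lambda>w. sum_mat (EP1 w))
       \<and> (\<forall>w\<in>braid3_words. trivial_braid3 w \<longrightarrow> sum_mat (EP1 w) = 0)"
proof (intro conjI ballI impI)
  fix w assume "w \<in> braid3_words"
  show "ones_mat 1 2 * EP1 w * ones_mat (length w) 1 = mat 1 1 (\<lambda>_. sum_mat (EP1 w))"
    by (rule ones_mat_mult_ones_mat) (simp add: EP1_def)
next
  show "braid3_invariant (\<lambda>w. sum_mat (EP1 w))"
    by (simp add: braid3_invariant_def sum_mat_EP1 exponent_sum_braid3_equal)
next
  fix w assume w: "w \<in> braid3_words" and "trivial_braid3 w"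
  then have "exponent_sum w = 0"
    using exponent_sum_braid3_equal[of w "[]"]
    by (simp add: trivial_braid3_def braid3_words_def exponent_sum_def)
  with w show "sum_mat (EP1 w) = 0"
    by (simp add: sum_mat_EP1)
qed

end
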